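(* Let $X$ be a non-zero real Banach space. Then the dual Banach space $X^*$ (with its dual norm) is not unconditionally almost square (UASQ).
   Context: All Banach spaces are real; $S_Z$ denotes the unit sphere of a Banach space $Z$. A Banach space $Z$ is called unconditionally almost square (UASQ) if for each $\varepsilon>0$ there exists a subset $\{x_\gamma\}_{\gamma\in\Gamma}\subseteq S_Z$ (depending on $\varepsilon$) such that: (1) for each finite set $\{y_1,\ldots,y_k\}\subseteq S_Z$ and each $\delta>0$ the set $\{\gamma\in\Gamma : \|y_i\pm x_\gamma\|\le 1+\delta\ \text{for all } i\in\{1,\ldots,k\}\}$ is non-empty; (2) for every finite subset $F$ of $\Gamma$ and every choice of signs $\xi_\gamma\in\{-1,1\}$, $\gamma\in F$, one has $\left\|\sum_{\gamma\in F}\xi_\gamma x_\gamma\right\|\le 1+\varepsilon$. *)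

theory Defs
  imports "HOL-Analysis.Bounded_Linear_Function"
begin

text \<open>
  The unconditionally almost square property of a real Banach space, given as a type.
  The family \<open>(x\<^sub>\<gamma>)\<close> is taken as the subset \<open>A\<close> of the unit sphere, indexed by itself: a family
  with \<open>x\<^sub>\<gamma> = x\<^sub>\<gamma>'\<close> for distinct indices violates the second condition for \<open>\<epsilon> < 1\<close>
  (equal signs give norm 2), so allowing repetitions would not change the notion.
  The test set \<open>{y\<^sub>1, \<dots>, y\<^sub>k}\<close> has \<open>k \<ge> 1\<close>; this only matters for the zero space, whose unit
  sphere is empty and which is then vacuously unconditionally almost square.
\<close>

definition uasq :: "'z::banach itself \<Rightarrow> bool" where
  "uasq _ \<longleftrightarrow>
    (\<forall>\<epsilon>>0::real. \<exists>A \<subseteq> sphere (0::'z) 1.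
      (\<forall>Y \<subseteq> sphere 0 1. \<forall>\<delta>>0::real. finite Y \<and> Y \<noteq> {} \<longrightarrow>
         {x \<in> A. \<forall>y\<in>Y. norm (y + x) \<le> 1 + \<delta> \<and> norm (y - x) \<le> 1 + \<delta>} \<noteq> {}) \<and>
      (\<forall>F \<subseteq> A. \<forall>\<xi> :: 'z \<Rightarrow> real. finite F \<and> (\<forall>x\<in>F. \<xi> x \<in> {-1, 1}) \<longrightarrow>
         norm (\<Sum>x\<in>F. \<xi> x *\<^sub>R x) \<le> 1 + \<epsilon>))"

end

theory Submission
  imports Defs "HOL-Analysis.Infinite_Sum"
begin

text \<open>
  A dual space cannot be unconditionally almost square because its almost square family can be
  summed. Let \<open>A\<close> be a family of unit functionals all of whose finite signed sums have norm at
  most \<open>M < 2\<close>. Choosing the signs according to the values at a vector \<open>x\<close> gives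
  \<open>\<Sum> \<bar>a x\<bar> \<le> M \<parallel>x\<parallel>\<close>, the sum being over all of \<open>A\<close>, so the family has a weak-star sum \<open>S\<close> in the dual,
  with \<open>\<parallel>S\<parallel> \<le> M\<close> (\<open>weak_star_sum\<close>). This \<open>S\<close> resembles every member of the family: at a unit
  vector that nearly norms \<open>a \<in> A\<close>, the member \<open>a\<close> uses up about \<open>1\<close> of the available mass \<open>M\<close>, so the
  other members contribute at least about \<open>-(M - 1)\<close>. Hence \<open>\<parallel>S + c a\<parallel> \<ge> 2 + c - M\<close> for
  \<open>c \<ge> 0\<close> (\<open>norm_weak_star_sum_plus\<close>). With \<open>c = \<parallel>S\<parallel>\<close> this says that the normalization
  \<open>y = S / \<parallel>S\<parallel>\<close> satisfies \<open>\<parallel>y + a\<parallel> \<ge> 1 + (2 - M) / M\<close> simultaneously for all \<open>a \<in> A\<close>, so no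
  \<open>a\<close> is almost orthogonal to \<open>y\<close> in the sense of the first UASQ condition.

  The argument needs some functional of norm one, since a space with empty unit sphere is
  vacuously UASQ. Thus the dual of a nonzero space must be shown to be nonzero, which is the
  Hahn-Banach theorem. It is derived here from Zorn's lemma applied to sublinear functionals
  instead of partially defined linear ones: a pointwise minimal sublinear functional is linear.
\<close>

section \<open>Minimal sublinear functionals and the Hahn-Banach theorem\<close>

text \<open>
  Homogeneity is stated as an inequality, which passes to infima more easily; the
  equality for positive \<open>c\<close> follows by applying it to \<open>1 / c\<close>.
\<close>

definition sublinear :: "('a::real_vector \<Rightarrow> real) \<Rightarrow> bool" where
  "sublinear p \<longleftrightarrow> (\<forall>x y. p (x + y) \<le> p x + p y) \<and> (\<forall>c x. 0 \<le> c \<longrightarrow> p (c *\<^sub>R x) \<le> c * p x)"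

lemma sublinear_add: "sublinear p \<Longrightarrow> p (x + y) \<le> p x + p y"
  and sublinear_scaleR_le: "sublinear p \<Longrightarrow> 0 \<le> c \<Longrightarrow> p (c *\<^sub>R x) \<le> c * p x"
  by (auto simp: sublinear_def)

lemma sublinear_zero:
  assumes "sublinear p"
  shows "p 0 = 0"
  using sublinear_add[OF assms, of 0 0] sublinear_scaleR_le[OF assms, of 0 0] by simp

lemma sublinear_scaleR:
  assumes p: "sublinear p" and c: "0 \<le> c"
  shows "p (c *\<^sub>R x) = c * p x"
proof (cases "c = 0")
  case True
  then show ?thesis by (simp add: sublinear_zero[OF p])
next
  case False
  with c have "0 < c" by simp
  then have "p x \<le> (1 / c) * p (c *\<^sub>R x)"
    using sublinear_scaleR_le[OF p, of "1 / c" "c *\<^sub>R x"] by simp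
  with \<open>0 < c\<close> have "c * p x \<le> p (c *\<^sub>R x)" by (simp add: field_simps)
  with sublinear_scaleR_le[OF p c, of x] show ?thesis by simp
qed

lemma sublinear_minus:
  assumes "sublinear p"
  shows "- p (- x) \<le> p x"
  using sublinear_add[OF assms, of x "- x"] sublinear_zero[OF assms] by simp

text \<open>
  The family is asked to be closed under sums and multiples up to passing to a smaller member.
  This form covers both infima below: that of a chain of sublinear functionals, where the smaller
  of two members serves, and that of the functions \<open>x \<mapsto> p (x + t y) - t p y\<close> for \<open>t \<ge> 0\<close>, where the
  parameters are added and scaled along with the vectors.
\<close>

lemma sublinear_INF:
  fixes g :: "'i \<Rightarrow> 'a::real_vector \<Rightarrow> real"
  assumes ne: "I \<noteq> {}"
    and bdd: "\<And>x. bdd_below ((\<lambda>i. g i x) ` I)"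
    and add: "\<And>i j x y. i \<in> I \<Longrightarrow> j \<in> I \<Longrightarrow> \<exists>k\<in>I. g k (x + y) \<le> g i x + g j y"
    and scale: "\<And>i c x. i \<in> I \<Longrightarrow> 0 \<le> c \<Longrightarrow> \<exists>k\<in>I. g k (c *\<^sub>R x) \<le> c * g i x"
  shows "sublinear (\<lambda>x. INF i\<in>I. g i x)"
  unfolding sublinear_def
proof (intro conjI allI impI)
  fix x y
  let ?q = "\<lambda>x. INF i\<in>I. g i x"
  have le: "?q (x + y) \<le> g i x + g j y" if "i \<in> I" "j \<in> I" for i j
    using add[OF that, of x y] cINF_lower[OF bdd[of "x + y"]] by (meson order_trans)
  have "?q (x + y) - g j y \<le> ?q x" if "j \<in> I" for j
    using le that by (intro cINF_greatest[OF ne]) (simp add: algebra_simps)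
  then have "?q (x + y) - ?q x \<le> ?q y"
    by (intro cINF_greatest[OF ne]) (simp add: algebra_simps)
  then show "?q (x + y) \<le> ?q x + ?q y" by simp
next
  fix c :: real and x
  assume c: "0 \<le> c"
  let ?q = "\<lambda>x. INF i\<in>I. g i x"
  have le: "?q (c *\<^sub>R x) \<le> c * g i x" if "i \<in> I" for i
    using scale[OF that c, of x] cINF_lower[OF bdd[of "c *\<^sub>R x"]] by (meson order_trans)
  show "?q (c *\<^sub>R x) \<le> c * ?q x"
  proof (cases "c = 0")
    case True
    with le ne show ?thesis by auto
  next
    case False
    with c have "0 < c" by simp
    then have "?q (c *\<^sub>R x) / c \<le> ?q x"
      using le by (intro cINF_greatest[OF ne]) (simp add: field_simps)
    with \<open>0 < c\<close> show ?thesis by (simp add: field_simps)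
  qed
qed

text \<open>
  The new functional is \<open>q x = (INF t\<ge>0. p (x + t y) - t p y)\<close>; taking \<open>t = 0\<close> gives \<open>q \<le> p\<close>, and
  \<open>t = 1\<close> gives the value at \<open>-y\<close>. The infimum is finite because
  \<open>t p y = p (t y) \<le> p (x + t y) + p (-x)\<close>.
\<close>

lemma sublinear_modify_along:
  fixes p :: "'a::real_vector \<Rightarrow> real"
  assumes p: "sublinear p"
  obtains q where "sublinear q" "\<And>x. q x \<le> p x" "q (- y) \<le> - p y"
proof
  define g where "g = (\<lambda>t x. p (x + t *\<^sub>R y) - t * p y)"
  let ?q = "\<lambda>x. INF t\<in>{0..}. g t x"
  have lower: "- p (- x) \<le> g t x" if "0 \<le> t" for t x
    using sublinear_add[OF p, of "x + t *\<^sub>R y" "- x"] sublinear_scaleR[OF p that, of y]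
    by (simp add: g_def)
  have bdd: "bdd_below ((\<lambda>t. g t x) ` {0..})" for x
    using lower[of _ x] by (intro bdd_belowI2[where m = "- p (- x)"]) auto
  show "sublinear ?q"
  proof (rule sublinear_INF)
    fix s t :: real and u v :: 'a
    assume "s \<in> {0..}" "t \<in> {0..}"
    moreover have "g (s + t) (u + v) \<le> g s u + g t v"
      using sublinear_add[OF p, of "u + s *\<^sub>R y" "v + t *\<^sub>R y"]
      by (simp add: g_def algebra_simps)
    ultimately show "\<exists>k\<in>{0..}. g k (u + v) \<le> g s u + g t v"
      by (intro bexI[of _ "s + t"]) auto
  next
    fix t c :: real and x :: 'a
    assume "t \<in> {0..}" and c: "0 \<le> c"
    moreover have "g (c * t) (c *\<^sub>R x) \<le> c * g t x"
      using sublinear_scaleR_le[OF p c, of "x + t *\<^sub>R y"]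
      by (simp add: g_def algebra_simps)
    ultimately show "\<exists>k\<in>{0..}. g k (c *\<^sub>R x) \<le> c * g t x"
      by (intro bexI[of _ "c * t"]) auto
  qed (use bdd in auto)
  show "?q x \<le> p x" for x
    using cINF_lower[OF bdd, of 0 x] by (simp add: g_def)
  show "?q (- y) \<le> - p y"
    using cINF_lower[OF bdd, of 1 "- y"] sublinear_zero[OF p] by (simp add: g_def)
qed

text \<open>
  Modifying a minimal \<open>m\<close> along \<open>y\<close> changes nothing, so \<open>m (-y) \<le> - m y\<close>. Hence \<open>m\<close> is odd, and an
  odd sublinear functional is linear.
\<close>

lemma linear_minimal_sublinear:
  fixes m :: "'a::real_vector \<Rightarrow> real"
  assumes m: "sublinear m"
    and min: "\<And>q. sublinear q \<Longrightarrow> (\<And>x. q x \<le> m x) \<Longrightarrow> q = m"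
  shows "linear m"
proof -
  have odd: "m (- y) = - m y" for y
  proof -
    obtain q where q: "sublinear q" "\<And>x. q x \<le> m x" "q (- y) \<le> - m y"
      using sublinear_modify_along[OF m] by blast
    have "q = m"
      using q(1,2) by (rule min)
    then have "m (- y) \<le> - m y" using q(3) by simp
    with sublinear_minus[OF m, of y] show ?thesis by simp
  qed
  show ?thesis
  proof (rule linearI)
    fix x y
    show "m (x + y) = m x + m y"
      using sublinear_add[OF m, of x y] sublinear_add[OF m, of "x + y" "- y"] odd[of y] by simp
  next
    fix c x
    show "m (c *\<^sub>R x) = c *\<^sub>R m x"
      using sublinear_scaleR[OF m, of c x] sublinear_scaleR[OF m, of "- c" x] odd[of "c *\<^sub>R x"]
      by (cases "0 \<le> c") auto
  qed
qed

text \<open>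
  Zorn's lemma applies because the values at \<open>x\<close> of the sublinear functionals below \<open>p\<close> are bounded
  below by \<open>- p (-x)\<close>, so the pointwise infimum of a nonempty chain is again such a functional.
\<close>

lemma linear_below_sublinear:
  fixes p :: "'a::real_vector \<Rightarrow> real"
  assumes p: "sublinear p"
  obtains f where "linear f" "\<And>x. f x \<le> p x"
proof -
  define P where "P = {q. sublinear q \<and> q \<le> p}"
  let ?R = "relation_of (\<lambda>q r. r \<le> q) P"
  have "\<exists>m\<in>P. \<forall>q\<in>P. q \<le> m \<longrightarrow> q = m"
  proof (rule predicate_Zorn)
    show "partial_order_on P ?R"
      by (auto simp: partial_order_on_def preorder_on_def refl_on_def trans_def antisym_def
          relation_of_def)
  next
    fix C
    assume "C \<in> Chains ?R"
    then have CP: "C \<subseteq> P" and chain: "\<And>q r. q \<in> C \<Longrightarrow> r \<in> C \<Longrightarrow> q \<le> r \<or> r \<le> q"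
      by (auto simp: Chains_def relation_of_def)
    show "\<exists>u\<in>P. \<forall>q\<in>C. u \<le> q"
    proof (cases "C = {}")
      case True
      with p show ?thesis by (auto simp: P_def)
    next
      case False
      have sub: "sublinear q" and below: "q x \<le> p x" if "q \<in> C" for q x
        using CP that by (auto simp: P_def le_fun_def)
      have "- p (- x) \<le> q x" if "q \<in> C" for q x
        using sublinear_minus[OF sub[OF that], of x] below[OF that, of "- x"] by simp
      then have bdd: "bdd_below ((\<lambda>q. q x) ` C)" for x
        by (intro bdd_belowI2)
      define u where "u = (\<lambda>x. INF q\<in>C. q x)"
      have "sublinear u"
        unfolding u_def
      proof (rule sublinear_INF[OF False bdd])
        fix q r :: "'a \<Rightarrow> real" and x y
        assume qr: "q \<in> C" "r \<in> C"
        from chain[OF qr] show "\<exists>k\<in>C. k (x + y) \<le> q x + r y"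
        proof
          assume "q \<le> r"
          then have "q (x + y) \<le> q x + r y"
            using sublinear_add[OF sub[OF qr(1)], of x y] le_funD[of q r y] by simp
          with qr show ?thesis by blast
        next
          assume "r \<le> q"
          then have "r (x + y) \<le> q x + r y"
            using sublinear_add[OF sub[OF qr(2)], of x y] le_funD[of r q x] by simp
          with qr show ?thesis by blast
        qed
      qed (use sub sublinear_scaleR_le in blast)
      moreover have lower: "u \<le> q" if "q \<in> C" for q
        using cINF_lower[OF bdd that] by (simp add: u_def le_fun_def)
      moreover have "u \<le> p"
      proof -
        from False obtain q where "q \<in> C" by blast
        then show ?thesis using lower CP by (auto simp: P_def intro: order_trans)
      qed
      ultimately show ?thesis by (auto simp: P_def)
    qed
  qed
  then obtain m where m: "m \<in> P" and min: "\<And>q. q \<in> P \<Longrightarrow> q \<le> m \<Longrightarrow> q = m"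
    by blast
  have "linear m"
  proof (rule linear_minimal_sublinear)
    show "sublinear m" using m by (simp add: P_def)
    show "q = m" if "sublinear q" "\<And>x. q x \<le> m x" for q
    proof (rule min)
      show "q \<le> m" using that(2) by (rule le_funI)
      then show "q \<in> P" using that(1) m by (auto simp: P_def)
    qed
  qed
  with m show ?thesis by (intro that[of m]) (auto simp: P_def le_fun_def)
qed

text \<open>
  Modifying the norm along \<open>x\<close> before passing to a linear functional forces its value at \<open>x\<close> to
  be \<open>\<parallel>x\<parallel>\<close>.
\<close>

lemma norming_functional_exists:
  fixes x :: "'a::real_normed_vector"
  assumes "x \<noteq> 0"
  obtains f :: "'a \<Rightarrow>\<^sub>L real" where "norm f = 1" "f x = norm x"
proof -
  have "sublinear (norm :: 'a \<Rightarrow> real)"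
    by (auto simp: sublinear_def norm_triangle_ineq)
  then obtain p :: "'a \<Rightarrow> real"
    where p: "sublinear p" "\<And>z. p z \<le> norm z" "p (- x) \<le> - norm x"
    using sublinear_modify_along by blast
  obtain g where g: "linear g" "\<And>z. g z \<le> p z"
    using linear_below_sublinear[OF p(1)] by blast
  have le: "g z \<le> norm z" for z
    using g(2)[of z] p(2)[of z] by simp
  have bound: "norm (g z) \<le> norm z * 1" for z
    using le[of z] le[of "- z"] linear_neg[OF g(1), of z] by simp
  have gx: "g x = norm x"
    using le[of x] g(2)[of "- x"] p(3) linear_neg[OF g(1), of x] by simp
  have "bounded_linear g"
    using bound by (intro bounded_linear_intro[of g 1]) (auto simp: linear_add[OF g(1)] linear_scale[OF g(1)])
  then have apply_g: "blinfun_apply (Blinfun g) = g"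
    by (rule bounded_linear_Blinfun_apply)
  have "norm (Blinfun g) \<le> 1"
    using bound by (intro norm_blinfun_bound) (auto simp: apply_g)
  moreover have "1 \<le> norm (Blinfun g)"
    using norm_blinfun[of "Blinfun g" x] assms by (simp add: apply_g gx)
  ultimately show ?thesis
    by (intro that[of "Blinfun g"]) (auto simp: apply_g gx)
qed

section \<open>Weak-star sums of unconditionally bounded families\<close>

lemma sum_abs_apply_le:
  fixes F :: "('a::real_normed_vector \<Rightarrow>\<^sub>L real) set"
  assumes signs: "\<And>\<xi> :: ('a \<Rightarrow>\<^sub>L real) \<Rightarrow> real. (\<forall>a\<in>F. \<xi> a \<in> {-1, 1}) \<Longrightarrow>
      norm (\<Sum>a\<in>F. \<xi> a *\<^sub>R a) \<le> M"
  shows "(\<Sum>a\<in>F. \<bar>blinfun_apply a x\<bar>) \<le> M * norm x"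
proof -
  define \<xi> :: "('a \<Rightarrow>\<^sub>L real) \<Rightarrow> real" where "\<xi> a = (if 0 \<le> a x then 1 else -1)" for a
  have "(\<Sum>a\<in>F. \<bar>blinfun_apply a x\<bar>) = (\<Sum>a\<in>F. \<xi> a *\<^sub>R a) x"
    by (auto simp: blinfun.sum_left blinfun.scaleR_left \<xi>_def intro!: sum.cong)
  also have "\<dots> \<le> norm (\<Sum>a\<in>F. \<xi> a *\<^sub>R a) * norm x"
    using norm_blinfun[of "\<Sum>a\<in>F. \<xi> a *\<^sub>R a" x] by simp
  also have "\<dots> \<le> M * norm x"
    by (intro mult_right_mono signs) (auto simp: \<xi>_def)
  finally show ?thesis .
qed

text \<open>
  This is where duality enters: the pointwise sum of the family is automatically a bounded
  functional, whereas the family itself is in general not summable in norm.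
\<close>

lemma weak_star_sum:
  fixes A :: "('a::real_normed_vector \<Rightarrow>\<^sub>L real) set"
  assumes bound: "\<And>F x. finite F \<Longrightarrow> F \<subseteq> A \<Longrightarrow> (\<Sum>a\<in>F. \<bar>blinfun_apply a x\<bar>) \<le> M * norm x"
    and M: "0 \<le> M"
  obtains S :: "'a \<Rightarrow>\<^sub>L real" where "norm S \<le> M" "\<And>x. ((\<lambda>a. blinfun_apply a x) has_sum S x) A"
proof -
  define s where "s x = (\<Sum>\<^sub>\<infinity>a\<in>A. blinfun_apply a x)" for x
  have abs: "(\<lambda>a. blinfun_apply a x) abs_summable_on A" for x
    unfolding abs_summable_iff_bdd_above
    using bound[of _ x] by (intro bdd_aboveI2[where M = "M * norm x"]) auto
  have has: "((\<lambda>a. blinfun_apply a x) has_sum s x) A" for x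
    unfolding s_def by (rule has_sum_infsum[OF abs_summable_summable[OF abs]])
  have s_bound: "norm (s x) \<le> norm x * M" for x
  proof -
    have "norm (s x) \<le> (\<Sum>\<^sub>\<infinity>a\<in>A. norm (blinfun_apply a x))"
      unfolding s_def by (rule norm_infsum_bound[OF abs])
    also have "\<dots> \<le> M * norm x"
      using bound[of _ x] by (intro infsum_le_finite_sums[OF abs]) auto
    finally show ?thesis by (simp add: mult.commute)
  qed
  have "bounded_linear s"
  proof (rule bounded_linear_intro[OF _ _ s_bound])
    fix x y
    have "((\<lambda>a. blinfun_apply a (x + y)) has_sum (s x + s y)) A"
      using has_sum_add[OF has[of x] has[of y]] by (simp add: blinfun.add_right)
    with has[of "x + y"] show "s (x + y) = s x + s y"
      by (rule has_sum_unique)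
  next
    fix c x
    have "((\<lambda>a. blinfun_apply a (c *\<^sub>R x)) has_sum (c * s x)) A"
      using has_sum_cmult_right[OF has[of x], of c] by (simp add: blinfun.scaleR_right)
    with has[of "c *\<^sub>R x"] show "s (c *\<^sub>R x) = c *\<^sub>R s x"
      by (simp add: has_sum_unique)
  qed
  then have apply_s: "blinfun_apply (Blinfun s) = s"
    by (rule bounded_linear_Blinfun_apply)
  have "norm (Blinfun s) \<le> M"
    using s_bound M by (intro norm_blinfun_bound) (auto simp: apply_s mult.commute)
  with has show ?thesis
    by (intro that[of "Blinfun s"]) (auto simp: apply_s)
qed

text \<open>
  At any \<open>x\<close>, the members other than \<open>a\<close> sum to at least \<open>-(M \<parallel>x\<parallel> - \<bar>a x\<bar>)\<close>, whence
  \<open>(S + c a) x \<ge> (2 + c) a x - M \<parallel>x\<parallel>\<close>. Reading this as a bound of the functional \<open>(2 + c) a\<close>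
  avoids choosing vectors that nearly norm \<open>a\<close>.
\<close>

lemma norm_weak_star_sum_plus:
  fixes A :: "('a::real_normed_vector \<Rightarrow>\<^sub>L real) set"
    and S :: "'a \<Rightarrow>\<^sub>L real"
  assumes bound: "\<And>F x. finite F \<Longrightarrow> F \<subseteq> A \<Longrightarrow> (\<Sum>a\<in>F. \<bar>blinfun_apply a x\<bar>) \<le> M * norm x"
    and M: "0 \<le> M"
    and S: "\<And>x. ((\<lambda>a. blinfun_apply a x) has_sum S x) A"
    and a: "a \<in> A" and c: "0 \<le> c"
  shows "(2 + c) * norm a \<le> norm (S + c *\<^sub>R a) + M"
proof -
  let ?N = "norm (S + c *\<^sub>R a) + M"
  have le: "(2 + c) * a x \<le> ?N * norm x" for x
  proof -
    have "((\<lambda>b. blinfun_apply b x) has_sum (S x - a x)) (A - {a})"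
      using a by (intro has_sum_Diff S has_sum_finiteI) auto
    then have "((\<lambda>b. - blinfun_apply b x) has_sum - (S x - a x)) (A - {a})"
      by (rule has_sum_uminusI)
    then have "- (S x - a x) \<le> M * norm x - \<bar>a x\<bar>"
    proof (rule has_sum_le_finite_sums)
      fix F
      assume F: "finite F" "F \<subseteq> A - {a}"
      have "(\<Sum>b\<in>F. - blinfun_apply b x) \<le> (\<Sum>b\<in>F. \<bar>blinfun_apply b x\<bar>)"
        by (intro sum_mono) simp
      moreover have "\<bar>a x\<bar> + (\<Sum>b\<in>F. \<bar>blinfun_apply b x\<bar>) \<le> M * norm x"
        using bound[of "insert a F" x] F a by (simp add: subset_Diff_insert subset_insertI2)
      ultimately show "(\<Sum>b\<in>F. - blinfun_apply b x) \<le> M * norm x - \<bar>a x\<bar>" by simp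
    qed
    then have "2 * a x - M * norm x \<le> S x" by simp
    then have "(2 + c) * a x \<le> (S + c *\<^sub>R a) x + M * norm x"
      by (simp add: blinfun.add_left blinfun.scaleR_left algebra_simps)
    also have "\<dots> \<le> ?N * norm x"
      using norm_blinfun[of "S + c *\<^sub>R a" x] by (simp add: algebra_simps)
    finally show ?thesis .
  qed
  have "norm ((2 + c) *\<^sub>R a) \<le> ?N"
  proof (rule norm_blinfun_bound)
    fix x
    show "norm (((2 + c) *\<^sub>R a) x) \<le> ?N * norm x"
      using le[of x] le[of "- x"]
      by (simp add: blinfun.scaleR_left blinfun.minus_right abs_le_iff)
  qed (use M in simp)
  with c show ?thesis by simp
qed

section \<open>Dual spaces are not unconditionally almost square\<close>

theorem theorem2p5:
  assumes "\<exists>x :: 'a::banach. x \<noteq> 0"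
  shows "\<not> uasq TYPE('a \<Rightarrow>\<^sub>L real)"
proof
  assume "uasq TYPE('a \<Rightarrow>\<^sub>L real)"
  \<comment> \<open>Any \<open>\<epsilon> < 1\<close> would do; with \<open>\<epsilon> = 1/2\<close> the bound on signed sums is \<open>M = 3/2\<close>.\<close>
  from this[unfolded uasq_def, THEN spec[of _ "1 / 2"], THEN mp]
  obtain A :: "('a \<Rightarrow>\<^sub>L real) set"
    where A: "A \<subseteq> sphere 0 1"
      and orth: "\<forall>Y \<subseteq> sphere 0 1. \<forall>\<delta>>0. finite Y \<and> Y \<noteq> {} \<longrightarrow>
        {a \<in> A. \<forall>y\<in>Y. norm (y + a) \<le> 1 + \<delta> \<and> norm (y - a) \<le> 1 + \<delta>} \<noteq> {}"
      and signs: "\<forall>F \<subseteq> A. \<forall>\<xi> :: ('a \<Rightarrow>\<^sub>L real) \<Rightarrow> real.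
        finite F \<and> (\<forall>a\<in>F. \<xi> a \<in> {-1, 1}) \<longrightarrow> norm (\<Sum>a\<in>F. \<xi> a *\<^sub>R a) \<le> 1 + 1 / 2"
    by (elim meta_impE exE conjE) simp_all
  have bound: "(\<Sum>a\<in>F. \<bar>blinfun_apply a x\<bar>) \<le> (3 / 2) * norm x" if "finite F" "F \<subseteq> A" for F x
    using signs that by (intro sum_abs_apply_le) simp
  obtain S :: "'a \<Rightarrow>\<^sub>L real"
    where S_le: "norm S \<le> 3 / 2" and S: "\<And>x. ((\<lambda>a. blinfun_apply a x) has_sum S x) A"
    using weak_star_sum[of A "3 / 2"] bound by auto
  have S_plus: "1 / 2 + c \<le> norm (S + c *\<^sub>R a)" if "a \<in> A" "0 \<le> c" for a c
    using norm_weak_star_sum_plus[OF bound _ S that] A that(1) by auto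
  obtain f :: "'a \<Rightarrow>\<^sub>L real" where "norm f = 1"
    using assms norming_functional_exists by metis
  then obtain a0 where "a0 \<in> A"
    using orth[rule_format, of "{f}" 1] by auto
  then have S_pos: "0 < norm S"
    using S_plus[of a0 0] by (simp del: zero_less_norm_iff)
  define y where "y = S /\<^sub>R norm S"
  have "norm y = 1"
    using S_pos by (simp add: y_def)
  \<comment> \<open>The tolerance \<open>1/4\<close> is chosen below \<open>(2 - M) / M = 1/3\<close>.\<close>
  then obtain a where a: "a \<in> A" and le: "norm (y + a) \<le> 1 + 1 / 4"
    using orth[rule_format, of "{y}" "1 / 4"] by auto
  have "S + norm S *\<^sub>R a = norm S *\<^sub>R (y + a)"
    using S_pos by (simp add: y_def algebra_simps)
  then have "1 / 2 + norm S \<le> norm S * norm (y + a)"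
    using S_plus[OF a, of "norm S"] by simp
  also have "\<dots> \<le> norm S * (5 / 4)"
    using le S_pos by (intro mult_left_mono) auto
  finally show False
    using S_le by simp
qed

end
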